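(* Let $\mathcal B$ and $\mathcal O$ be two bounded (closed) convex polygons in $\mathbb{R}^2$, and let $V\in\mathbb{R}^{2\times M}$ and $O\in\mathbb{R}^{2\times N}$ be the matrices whose columns are all the vertices of $\mathcal B$ and of $\mathcal O$, respectively. Then $\mathcal B\cap\mathcal O=\emptyset$ if and only if there exist $\boldsymbol{\lambda}\in\mathbb{R}^2$ and $\mu_1,\mu_2\in\mathbb{R}$ such that $$\boldsymbol{\lambda}^\top V>\mu_1\boldsymbol{1}^\top,\qquad \boldsymbol{\lambda}^\top O<\mu_2\boldsymbol{1}^\top,\qquad \mu_1>\mu_2,\qquad \|\boldsymbol{\lambda}\|>0.$$
   Context: Inequalities between vectors are componentwise, and $\boldsymbol{1}=(1,\ldots,1)^\top$ is the all-ones vector of the appropriate length. A bounded convex polygon is a nonempty bounded set of the form $\{\boldsymbol{q}\in\mathbb{R}^2\mid C\boldsymbol{q}\le\boldsymbol{d}\}$ with $C\in\mathbb{R}^{M\times 2}$, $\boldsymbol{d}\in\mathbb{R}^M$. *)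

theory Defs
  imports "HOL-Analysis.Analysis"
begin

(* On vectors, the library order \<le> is componentwise, but its strict part < only means
   "\<le> and not equal"; the strict componentwise order is therefore defined here. *)
definition vec_less :: "real ^ 'n \<Rightarrow> real ^ 'n \<Rightarrow> bool"  (infix "<\<^sub>v" 50)
  where "x <\<^sub>v y \<longleftrightarrow> (\<forall>i. x $ i < y $ i)"

definition bounded_convex_polygon :: "real ^ 2 ^ 'm \<Rightarrow> real ^ 'm \<Rightarrow> (real ^ 2) set \<Rightarrow> bool"
  where "bounded_convex_polygon C d P \<longleftrightarrow>
    P = {q. C *v q \<le> d} \<and> P \<noteq> {} \<and> bounded P"

(* Only the set of columns matters: their order is arbitrary and repetitions are allowed. *)
definition vertex_matrix :: "real ^ 'm ^ 2 \<Rightarrow> (real ^ 2) set \<Rightarrow> bool"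
  where "vertex_matrix V P \<longleftrightarrow> columns V = {v. v extreme_point_of P}"

end

theory Submission
  imports Defs
begin

text \<open>A compact convex set is the convex hull of its extreme points, and half-planes are convex;
  so strict bounds on a linear functional over the vertices of a polygon and over the polygon itself
  are equivalent. What remains is strict separation of disjoint compact convex sets. Separation gives
  one strict threshold \<open>b\<close>; compactness of \<open>B\<close> leaves a gap above it, where \<open>\<mu>\<^sub>1 > \<mu>\<^sub>2 = b\<close> fits.\<close>

text \<open>The componentwise order yields one closed half-plane per row of \<open>C\<close>;
  convexity and closedness of \<open>P\<close> are both read off from this form.\<close>

lemma bounded_convex_polygon_eq_Inter_halfspaces:
  assumes "bounded_convex_polygon C d P"
  shows "P = (\<Inter>i. {q. row i C \<bullet> q \<le> d $ i})"
  using assms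
  by (auto simp: bounded_convex_polygon_def less_eq_vec_def matrix_vector_mult_def
      inner_vec_def row_def)

lemma bounded_convex_polygon_imp_convex:
  assumes "bounded_convex_polygon C d P"
  shows "convex P"
  unfolding bounded_convex_polygon_eq_Inter_halfspaces[OF assms]
  by (intro convex_INT convex_halfspace_le)

lemma bounded_convex_polygon_imp_compact:
  assumes "bounded_convex_polygon C d P"
  shows "compact P"
proof -
  have "closed P"
    unfolding bounded_convex_polygon_eq_Inter_halfspaces[OF assms]
    by (intro closed_INT ballI closed_halfspace_le)
  moreover have "bounded P"
    using assms unfolding bounded_convex_polygon_def by blast
  ultimately show ?thesis
    by (simp add: compact_eq_bounded_closed)
qed

lemma vector_matrix_mult_component:
  fixes x :: "real ^ 'n"
  shows "(x v* A) $ j = x \<bullet> column j A"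
  by (simp add: vector_matrix_mult_def inner_vec_def column_def mult.commute)

text \<open>Entry \<open>j\<close> of \<open>x v* V\<close> pairs \<open>x\<close> with column
  \<open>j\<close>, and the columns are exactly the vertices, so their order and repetitions do not
  matter.\<close>

lemma less_vector_matrix_mult_iff:
  fixes x :: "real ^ 2"
  assumes "vertex_matrix V P"
  shows "m *\<^sub>R 1 <\<^sub>v x v* V \<longleftrightarrow> (\<forall>v. v extreme_point_of P \<longrightarrow> m < x \<bullet> v)"
proof -
  have "(\<forall>v. v extreme_point_of P \<longrightarrow> m < x \<bullet> v) \<longleftrightarrow> (\<forall>v \<in> columns V. m < x \<bullet> v)"
    using assms by (simp add: vertex_matrix_def)
  then show ?thesis
    by (auto simp: vec_less_def vector_matrix_mult_component columns_def)
qed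

lemma vector_matrix_mult_less_iff:
  fixes x :: "real ^ 2"
  assumes "vertex_matrix V P"
  shows "x v* V <\<^sub>v m *\<^sub>R 1 \<longleftrightarrow> (\<forall>v. v extreme_point_of P \<longrightarrow> x \<bullet> v < m)"
proof -
  have "(\<forall>v. v extreme_point_of P \<longrightarrow> x \<bullet> v < m) \<longleftrightarrow> (\<forall>v \<in> columns V. x \<bullet> v < m)"
    using assms by (simp add: vertex_matrix_def)
  then show ?thesis
    by (auto simp: vec_less_def vector_matrix_mult_component columns_def)
qed

text \<open>By Minkowski's theorem the hull of the extreme points is all of \<open>S\<close> without
  taking a closure, so \<open>H\<close> may be an open half-plane and strict bounds carry
  over.\<close>

lemma subset_convex_if_extreme_points:
  fixes S :: "'a::euclidean_space set"
  assumes "compact S" "convex S" "convex H" "\<And>v. v extreme_point_of S \<Longrightarrow> v \<in> H"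
  shows "S \<subseteq> H"
proof -
  have "S = convex hull {v. v extreme_point_of S}"
    using assms by (intro Krein_Milman_Minkowski)
  also have "\<dots> \<subseteq> H"
    using assms by (intro hull_minimal) auto
  finally show ?thesis .
qed

theorem proposition4:
  fixes B Ob :: "(real ^ 2) set"
    and C\<^sub>B :: "real ^ 2 ^ 'k" and d\<^sub>B :: "real ^ 'k"
    and C\<^sub>O :: "real ^ 2 ^ 'l" and d\<^sub>O :: "real ^ 'l"
    and V :: "real ^ 'm ^ 2" and W :: "real ^ 'n ^ 2"
  assumes "bounded_convex_polygon C\<^sub>B d\<^sub>B B"
    and "bounded_convex_polygon C\<^sub>O d\<^sub>O Ob"
    and "vertex_matrix V B"
    and "vertex_matrix W Ob"
  shows "B \<inter> Ob = {} \<longleftrightarrow>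
    (\<exists>(lam :: real ^ 2) (\<mu>\<^sub>1 :: real) (\<mu>\<^sub>2 :: real).
      \<mu>\<^sub>1 *\<^sub>R 1 <\<^sub>v lam v* V \<and> lam v* W <\<^sub>v \<mu>\<^sub>2 *\<^sub>R 1 \<and> \<mu>\<^sub>1 > \<mu>\<^sub>2 \<and> norm lam > 0)"
    (is "?L \<longleftrightarrow> ?R")
proof -
  note vertex_iffs = less_vector_matrix_mult_iff[OF assms(3)] vector_matrix_mult_less_iff[OF assms(4)]
  have B: "compact B" "convex B" "B \<noteq> {}"
    and Ob: "compact Ob" "convex Ob" "Ob \<noteq> {}"
    using assms(1,2)[THEN bounded_convex_polygon_imp_compact]
      assms(1,2)[THEN bounded_convex_polygon_imp_convex]
      assms(1,2)[unfolded bounded_convex_polygon_def]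
    by blast+
  show ?thesis
  proof
    assume ?L
    \<comment> \<open>\<open>Ob\<close> is taken first so that it falls on the lower side of the
      line.\<close>
    then obtain a b where a: "\<forall>x\<in>Ob. a \<bullet> x < b" "\<forall>x\<in>B. b < a \<bullet> x"
      using separating_hyperplane_closed_compact[of Ob B] B Ob compact_imp_closed by blast
    \<comment> \<open>The minimum of the functional on \<open>B\<close> is attained at
      \<open>p\<close>, hence still exceeds \<open>b\<close>; any \<open>m\<close> strictly between
      can serve as \<open>\<mu>\<^sub>1\<close>.\<close>
    obtain p where p: "p \<in> B" "\<forall>x\<in>B. a \<bullet> p \<le> a \<bullet> x"
      using continuous_attains_inf[of B "\<lambda>x. a \<bullet> x"] B
        continuous_on_inner[OF continuous_on_const continuous_on_id] by blast
    obtain m where m: "b < m" "m < a \<bullet> p"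
      using a(2) p(1) dense by blast
    \<comment> \<open>Otherwise a point of \<open>Ob\<close> would give 0 < b and a point of
      \<open>B\<close> would give b < 0.\<close>
    have "a \<noteq> 0"
      using a B(3) Ob(3) by fastforce
    \<comment> \<open>Vertices lie in their polygon, so the bounds on \<open>B\<close> and
      \<open>Ob\<close> apply to them.\<close>
    moreover have "m *\<^sub>R 1 <\<^sub>v a v* V" "a v* W <\<^sub>v b *\<^sub>R 1"
      unfolding vertex_iffs using a p m by (auto simp: extreme_point_of_def intro: less_le_trans)
    ultimately show ?R
      using m(1) by auto
  next
    assume ?R
    then obtain a m b where a: "\<And>v. v extreme_point_of B \<Longrightarrow> m < a \<bullet> v"
        "\<And>v. v extreme_point_of Ob \<Longrightarrow> a \<bullet> v < b" and "b < m"
      unfolding vertex_iffs by blast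
    have "B \<subseteq> {x. m < a \<bullet> x}"
      using B a(1) convex_halfspace_gt[of m a] by (intro subset_convex_if_extreme_points) auto
    moreover have "Ob \<subseteq> {x. a \<bullet> x < b}"
      using Ob a(2) convex_halfspace_lt[of a b] by (intro subset_convex_if_extreme_points) auto
    \<comment> \<open>At a common point the functional would be above \<open>m\<close> and below
      \<open>b\<close>, against b < m.\<close>
    ultimately show ?L
      using \<open>b < m\<close> by fastforce
  qed
qed

end
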